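(* Let $\Bbbk$ be a field of characteristic zero. Every one-dimensional $\mathbb{Z}_{\ge0}$-graded Noetherian $\Bbbk$-algebra $S=\bigoplus_{i\ge0}S_i$ with $S_0=\Bbbk$ is nearly regular.
   Context: For a Noetherian $\mathbb{Z}_{\ge0}$-graded ring $S$ with $S_0=\Bbbk$ a field, let $\mathfrak m_S=\bigoplus_{i>0}S_i$. For an $S$-module $M$, $\operatorname{tr}_S(M)=\sum_{f\in\operatorname{Hom}_S(M,S)}f(M)$. $\Omega^i_{S/\Bbbk}=\bigwedge^i_S\Omega^1_{S/\Bbbk}$ is the $i$-th exterior power of the module of Kähler differentials. $S$ is called nearly regular if $\operatorname{tr}_S(\Omega^{\dim S}_{S/\Bbbk})\supseteq\mathfrak m_S$. *)

theory Defs
  imports "HOL-Algebra.Ring_Divisibility" "HOL-Algebra.Module" "HOL-Algebra.QuotRing" "HOL-Library.Extended_Nat"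
begin

section \<open>Krull dimension\<close>

text \<open>Supremum of the lengths \<open>n\<close> of chains \<open>P 0 \<subset> P 1 \<subset> \<dots> \<subset> P n\<close> of prime ideals
  (for the zero ring this convention gives \<open>0\<close>).\<close>

definition krull_dim :: "('a, 'r) ring_scheme \<Rightarrow> enat" where
  "krull_dim R =
     Sup {enat n | n. \<exists>P. (\<forall>i\<le>n. primeideal (P i) R) \<and> (\<forall>i<n. P i \<subset> P (Suc i))}"


section \<open>Rings graded by the natural numbers\<close>

definition homogeneous_decomp ::
    "('a, 'r) ring_scheme \<Rightarrow> (nat \<Rightarrow> 'a set) \<Rightarrow> (nat \<Rightarrow> 'a) \<Rightarrow> 'a \<Rightarrow> bool" where
  "homogeneous_decomp R gr a x \<longleftrightarrow>
     (\<forall>i. a i \<in> gr i) \<and> finite {i. a i \<noteq> \<zero>\<^bsub>R\<^esub>} \<and> x = (\<Oplus>\<^bsub>R\<^esub>i\<in>{i. a i \<noteq> \<zero>\<^bsub>R\<^esub>}. a i)"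

locale graded_ring = cring R for R (structure) +
  fixes gr :: "nat \<Rightarrow> 'a set"
  assumes gr_subgroup: "subgroup (gr i) (add_monoid R)"
    and gr_mult: "\<lbrakk>x \<in> gr i; y \<in> gr j\<rbrakk> \<Longrightarrow> x \<otimes> y \<in> gr (i + j)"
    and gr_decomp: "x \<in> carrier R \<Longrightarrow> \<exists>!a. homogeneous_decomp R gr a x"

definition irrelevant_ideal :: "('a, 'r) ring_scheme \<Rightarrow> (nat \<Rightarrow> 'a set) \<Rightarrow> 'a set" where
  "irrelevant_ideal R gr = {x. \<exists>a. homogeneous_decomp R gr a x \<and> a 0 = \<zero>\<^bsub>R\<^esub>}"


section \<open>Modules\<close>

text \<open>The \<open>module\<close> record extends the \<open>ring\<close> record; the fields \<open>mult\<close> and \<open>one\<close> play no role for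
  modules and are left unspecified.\<close>

definition free_module :: "('a, 'r) ring_scheme \<Rightarrow> 'x set \<Rightarrow> ('a, 'x \<Rightarrow> 'a) module" where
  "free_module R X =
     \<lparr>carrier = {f. (\<forall>x. f x \<in> carrier R) \<and> (\<forall>x. x \<notin> X \<longrightarrow> f x = \<zero>\<^bsub>R\<^esub>) \<and> finite {x. f x \<noteq> \<zero>\<^bsub>R\<^esub>}},
      mult = undefined, one = undefined,
      zero = (\<lambda>x. \<zero>\<^bsub>R\<^esub>), add = (\<lambda>f g x. f x \<oplus>\<^bsub>R\<^esub> g x), smult = (\<lambda>a f x. a \<otimes>\<^bsub>R\<^esub> f x)\<rparr>"

definition free_gen :: "('a, 'r) ring_scheme \<Rightarrow> 'x \<Rightarrow> 'x \<Rightarrow> 'a" where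
  "free_gen R x = (\<lambda>y. if y = x then \<one>\<^bsub>R\<^esub> else \<zero>\<^bsub>R\<^esub>)"

definition generated_submodule ::
    "('a, 'r) ring_scheme \<Rightarrow> ('a, 'b, 'm) module_scheme \<Rightarrow> 'b set \<Rightarrow> 'b set" where
  "generated_submodule R M X = \<Inter>{N. submodule N R M \<and> X \<subseteq> N}"

definition quotient_module ::
    "('a, 'b, 'm) module_scheme \<Rightarrow> 'b set \<Rightarrow> ('a, 'b set) module" where
  "quotient_module M N =
     \<lparr>carrier = a_rcosets\<^bsub>M\<^esub> N, mult = undefined, one = undefined,
      zero = N, add = set_add M, smult = (\<lambda>a A. \<Union>x\<in>A. N +>\<^bsub>M\<^esub> (a \<odot>\<^bsub>M\<^esub> x))\<rparr>"

definition regular_module :: "('a, 'r) ring_scheme \<Rightarrow> ('a, 'a) module" where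
  "regular_module R =
     \<lparr>carrier = carrier R, mult = mult R, one = one R, zero = zero R, add = add R, smult = mult R\<rparr>"

definition linear_maps ::
    "('a, 'r) ring_scheme \<Rightarrow> ('a, 'b, 'm) module_scheme \<Rightarrow> ('a, 'c, 'n) module_scheme \<Rightarrow> ('b \<Rightarrow> 'c) set" where
  "linear_maps R M N =
     {f. f \<in> carrier M \<rightarrow> carrier N \<and>
         (\<forall>x\<in>carrier M. \<forall>y\<in>carrier M. f (x \<oplus>\<^bsub>M\<^esub> y) = f x \<oplus>\<^bsub>N\<^esub> f y) \<and>
         (\<forall>a\<in>carrier R. \<forall>x\<in>carrier M. f (a \<odot>\<^bsub>M\<^esub> x) = a \<odot>\<^bsub>N\<^esub> f x)}"

text \<open>The sum of the submodules \<open>f ` carrier M\<close> over all \<open>f \<in> Hom(M, R)\<close>: its elements are the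
  finite sums of elements of these submodules.\<close>

definition trace_ideal :: "('a, 'r) ring_scheme \<Rightarrow> ('a, 'b, 'm) module_scheme \<Rightarrow> 'a set" where
  "trace_ideal R M =
     {(\<Oplus>\<^bsub>R\<^esub>f\<in>F. g f) | F g.
        finite F \<and> F \<subseteq> linear_maps R M (regular_module R) \<and> (\<forall>f\<in>F. g f \<in> f ` carrier M)}"


section \<open>Exterior powers\<close>

text \<open>The \<open>i\<close>-th exterior power is presented by generators \<open>m\<^sub>1 \<and> \<dots> \<and> m\<^sub>i\<close>, encoded as lists of
  length \<open>i\<close>, modulo multilinearity and the alternating property. For \<open>i = 0\<close> there are no
  relations, and the result is free on the empty list.\<close>

definition ext_gens :: "('a, 'b, 'm) module_scheme \<Rightarrow> nat \<Rightarrow> 'b list set" where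
  "ext_gens M i = {ms. set ms \<subseteq> carrier M \<and> length ms = i}"

definition ext_rels ::
    "('a, 'r) ring_scheme \<Rightarrow> ('a, 'b, 'm) module_scheme \<Rightarrow> nat \<Rightarrow> ('b list \<Rightarrow> 'a) set" where
  "ext_rels R M i = (let F = free_module R (ext_gens M i); e = free_gen R in
     {e (ms[j := x \<oplus>\<^bsub>M\<^esub> y]) \<ominus>\<^bsub>F\<^esub> (e (ms[j := x]) \<oplus>\<^bsub>F\<^esub> e (ms[j := y])) | ms j x y.
        ms \<in> ext_gens M i \<and> j < i \<and> x \<in> carrier M \<and> y \<in> carrier M} \<union>
     {e (ms[j := a \<odot>\<^bsub>M\<^esub> x]) \<ominus>\<^bsub>F\<^esub> (a \<odot>\<^bsub>F\<^esub> e (ms[j := x])) | ms j a x.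
        ms \<in> ext_gens M i \<and> j < i \<and> a \<in> carrier R \<and> x \<in> carrier M} \<union>
     {e ms | ms. ms \<in> ext_gens M i \<and> (\<exists>j l. j < l \<and> l < i \<and> ms ! j = ms ! l)})"

definition exterior_power ::
    "('a, 'r) ring_scheme \<Rightarrow> ('a, 'b, 'm) module_scheme \<Rightarrow> nat \<Rightarrow> ('a, ('b list \<Rightarrow> 'a) set) module" where
  "exterior_power R M i = (let F = free_module R (ext_gens M i) in
     quotient_module F (generated_submodule R F (ext_rels R M i)))"


section \<open>Kaehler differentials\<close>

text \<open>\<open>S\<close> is an algebra over \<open>K\<close> in the sense of \<^locale>\<open>algebra\<close>. The generator indexed by \<open>x\<close>
  stands for \<open>dx\<close>; the relations are additivity, the Leibniz rule, and \<open>dc = 0\<close> for the image \<open>c\<close>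
  in \<open>S\<close> of an element of \<open>K\<close>.\<close>

definition kaehler_rels ::
    "('k, 'q) ring_scheme \<Rightarrow> ('k, 's, 'm) module_scheme \<Rightarrow> ('s \<Rightarrow> 's) set" where
  "kaehler_rels K S = (let F = free_module S (carrier S); d = free_gen S in
     {d (x \<oplus>\<^bsub>S\<^esub> y) \<ominus>\<^bsub>F\<^esub> (d x \<oplus>\<^bsub>F\<^esub> d y) | x y. x \<in> carrier S \<and> y \<in> carrier S} \<union>
     {d (x \<otimes>\<^bsub>S\<^esub> y) \<ominus>\<^bsub>F\<^esub> (x \<odot>\<^bsub>F\<^esub> d y \<oplus>\<^bsub>F\<^esub> y \<odot>\<^bsub>F\<^esub> d x) | x y. x \<in> carrier S \<and> y \<in> carrier S} \<union>
     {d (c \<odot>\<^bsub>S\<^esub> \<one>\<^bsub>S\<^esub>) | c. c \<in> carrier K})"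

definition kaehler_differentials ::
    "('k, 'q) ring_scheme \<Rightarrow> ('k, 's, 'm) module_scheme \<Rightarrow> ('s, ('s \<Rightarrow> 's) set) module" where
  "kaehler_differentials K S = (let F = free_module S (carrier S) in
     quotient_module F (generated_submodule S F (kaehler_rels K S)))"

definition differential_forms ::
    "('k, 'q) ring_scheme \<Rightarrow> ('k, 's, 'm) module_scheme \<Rightarrow> nat
       \<Rightarrow> ('s, (('s \<Rightarrow> 's) set list \<Rightarrow> 's) set) module" where
  "differential_forms K S i = exterior_power S (kaehler_differentials K S) i"


section \<open>Nearly regular graded algebras\<close>

text \<open>Only meant for Noetherian graded \<open>S\<close> with \<open>S\<^sub>0 = K\<close>; the Krull dimension of such \<open>S\<close> is
  finite.\<close>

definition nearly_regular ::
    "('k, 'q) ring_scheme \<Rightarrow> ('k, 's, 'm) module_scheme \<Rightarrow> (nat \<Rightarrow> 's set) \<Rightarrow> bool" where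
  "nearly_regular K S gr \<longleftrightarrow>
     (\<exists>n. krull_dim S = enat n \<and> irrelevant_ideal S gr \<subseteq> trace_ideal S (differential_forms K S n))"

end

theory Submission
  imports Defs
begin

text \<open>The Euler derivation multiplies the homogeneous component of degree \<open>i\<close> by \<open>i\<close>. It kills
  \<open>S\<^sub>0 = K\<close>, so it is \<open>K\<close>-linear and corresponds to an \<open>S\<close>-linear map from the Kaehler
  differentials, that is from their first exterior power, to \<open>S\<close>. In characteristic zero each
  \<open>i > 0\<close> is invertible in \<open>K\<close>, so the Euler derivation maps onto the irrelevant ideal and the image
  of this single linear map already contains that ideal.\<close>

section \<open>Linear forms on free modules and quotients\<close>

lemma free_module_simps [simp]:
  "carrier (free_module R X) =
     {f. (\<forall>x. f x \<in> carrier R) \<and> (\<forall>x. x \<notin> X \<longrightarrow> f x = \<zero>\<^bsub>R\<^esub>) \<and> finite {x. f x \<noteq> \<zero>\<^bsub>R\<^esub>}}"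
  "\<zero>\<^bsub>free_module R X\<^esub> = (\<lambda>x. \<zero>\<^bsub>R\<^esub>)"
  "f \<oplus>\<^bsub>free_module R X\<^esub> g = (\<lambda>x. f x \<oplus>\<^bsub>R\<^esub> g x)"
  "a \<odot>\<^bsub>free_module R X\<^esub> f = (\<lambda>x. a \<otimes>\<^bsub>R\<^esub> f x)"
  by (simp_all add: free_module_def)

lemma regular_module_simps [simp]:
  "carrier (regular_module R) = carrier R"
  "x \<oplus>\<^bsub>regular_module R\<^esub> y = x \<oplus>\<^bsub>R\<^esub> y"
  "a \<odot>\<^bsub>regular_module R\<^esub> x = a \<otimes>\<^bsub>R\<^esub> x"
  by (simp_all add: regular_module_def)

lemma quotient_module_simps [simp]:
  "carrier (quotient_module M N) = a_rcosets\<^bsub>M\<^esub> N"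
  "A \<oplus>\<^bsub>quotient_module M N\<^esub> B = A <+>\<^bsub>M\<^esub> B"
  "a \<odot>\<^bsub>quotient_module M N\<^esub> A = (\<Union>x\<in>A. N +>\<^bsub>M\<^esub> (a \<odot>\<^bsub>M\<^esub> x))"
  by (simp_all add: quotient_module_def)

lemma (in cring) free_module_module: "module R (free_module R X)"
proof -
  have fin_add: "finite {x. f x \<oplus> g x \<noteq> \<zero>}" if "finite {x. f x \<noteq> \<zero>}" "finite {x. g x \<noteq> \<zero>}"
    for f g :: "'x \<Rightarrow> 'a"
    by (rule finite_subset[OF _ finite_UnI[OF that]]) auto
  have fin_smult: "finite {x. a \<otimes> f x \<noteq> \<zero>}" if "finite {x. f x \<noteq> \<zero>}" "a \<in> carrier R"
    for f :: "'x \<Rightarrow> 'a" and a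
    by (rule finite_subset[OF _ that(1)]) (use that in auto)
  have fin_minus: "finite {x. \<ominus> f x \<noteq> \<zero>}" if "finite {x. f x \<noteq> \<zero>}" for f :: "'x \<Rightarrow> 'a"
    by (rule finite_subset[OF _ that]) auto
  have group: "abelian_group (free_module R X)"
  proof (rule abelian_groupI)
    fix f assume "f \<in> carrier (free_module R X)"
    then show "\<exists>g\<in>carrier (free_module R X). g \<oplus>\<^bsub>free_module R X\<^esub> f = \<zero>\<^bsub>free_module R X\<^esub>"
      by (intro bexI[of _ "\<lambda>x. \<ominus> f x"]) (auto simp: l_neg fin_minus)
  qed (auto simp: fin_add a_ac)
  show ?thesis
    by (intro moduleI is_cring group) (auto simp: fin_smult l_distr r_distr m_assoc)
qed

lemma (in cring) free_gen_closed:
  "x \<in> X \<Longrightarrow> free_gen R x \<in> carrier (free_module R X)"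
  by (auto simp: free_gen_def)

text \<open>The linear form on the free module with prescribed values \<open>h x\<close> on the
  basis elements \<open>free_gen R x\<close>. Summing over the support keeps the sum finite and
  makes the formula independent of the basis set \<open>X\<close>.\<close>

definition linear_extension :: "('a, 'r) ring_scheme \<Rightarrow> ('x \<Rightarrow> 'a) \<Rightarrow> ('x \<Rightarrow> 'a) \<Rightarrow> 'a" where
  "linear_extension R h f = (\<Oplus>\<^bsub>R\<^esub>x\<in>{x. f x \<noteq> \<zero>\<^bsub>R\<^esub>}. f x \<otimes>\<^bsub>R\<^esub> h x)"

text \<open>Supports change under addition and scalar multiplication. Extra indices contribute only
  zero terms, so the sums in a linearity identity can be taken over one common index set.\<close>

lemma (in cring) linear_extension_superset:
  assumes "f \<in> carrier (free_module R X)" "h \<in> X \<rightarrow> carrier R"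
    and "finite A" "{x. f x \<noteq> \<zero>} \<subseteq> A" "A \<subseteq> X"
  shows "linear_extension R h f = (\<Oplus>x\<in>A. f x \<otimes> h x)"
  unfolding linear_extension_def using assms
  by (intro add.finprod_mono_neutral_cong_left) (auto simp: Pi_iff subset_iff)

lemma (in cring) linear_extension_linear:
  assumes h: "h \<in> X \<rightarrow> carrier R"
  shows "linear_extension R h \<in> linear_maps R (free_module R X) (regular_module R)"
proof -
  interpret F: module R "free_module R X" by (rule free_module_module)
  let ?F = "free_module R X"
  have supp: "{x. f x \<noteq> \<zero>} \<subseteq> X" "finite {x. f x \<noteq> \<zero>}" if "f \<in> carrier ?F" for f
    using that by auto
  have clos: "f x \<otimes> h x \<in> carrier R" if "f \<in> carrier ?F" "x \<in> X" for f x
    using that h by auto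
  have "linear_extension R h f \<in> carrier R" if "f \<in> carrier ?F" for f
    unfolding linear_extension_def using clos[OF that] supp[OF that] by (intro finsum_closed) auto
  moreover have "linear_extension R h (f \<oplus>\<^bsub>?F\<^esub> g) = linear_extension R h f \<oplus> linear_extension R h g"
    if f: "f \<in> carrier ?F" and g: "g \<in> carrier ?F" for f g
  proof -
    let ?A = "{x. f x \<noteq> \<zero>} \<union> {x. g x \<noteq> \<zero>}"
    have A: "finite ?A" "?A \<subseteq> X" using supp[OF f] supp[OF g] by auto
    have "linear_extension R h (f \<oplus>\<^bsub>?F\<^esub> g) = (\<Oplus>x\<in>?A. (f \<oplus>\<^bsub>?F\<^esub> g) x \<otimes> h x)"
      using f g by (intro linear_extension_superset[OF F.M.a_closed[OF f g] h A(1) _ A(2)]) auto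
    also have "\<dots> = (\<Oplus>x\<in>?A. f x \<otimes> h x \<oplus> g x \<otimes> h x)"
    proof (rule add.finprod_cong')
      show "(\<lambda>x. f x \<otimes> h x \<oplus> g x \<otimes> h x) \<in> ?A \<rightarrow> carrier R"
        using clos[OF f] clos[OF g] A(2) by blast
      show "(f \<oplus>\<^bsub>?F\<^esub> g) x \<otimes> h x = f x \<otimes> h x \<oplus> g x \<otimes> h x" if "x \<in> ?A" for x
      proof -
        have "h x \<in> carrier R" using that A(2) h by blast
        then show ?thesis using f g by (simp add: l_distr)
      qed
    qed simp
    also have "\<dots> = (\<Oplus>x\<in>?A. f x \<otimes> h x) \<oplus> (\<Oplus>x\<in>?A. g x \<otimes> h x)"
      using clos[OF f] clos[OF g] A(2) by (intro finsum_addf) blast+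
    also have "\<dots> = linear_extension R h f \<oplus> linear_extension R h g"
      using linear_extension_superset[OF f h A(1) _ A(2)] linear_extension_superset[OF g h A(1) _ A(2)]
      by simp
    finally show ?thesis .
  qed
  moreover have "linear_extension R h (a \<odot>\<^bsub>?F\<^esub> f) = a \<otimes> linear_extension R h f"
    if a: "a \<in> carrier R" and f: "f \<in> carrier ?F" for a f
  proof -
    \<comment> \<open>The support of \<open>f\<close> serves both sides, even though
      \<open>a\<close> may annihilate some nonzero coefficients and shrink the support of the
      multiple.\<close>
    let ?A = "{x. f x \<noteq> \<zero>}"
    have "linear_extension R h (a \<odot>\<^bsub>?F\<^esub> f) = (\<Oplus>x\<in>?A. (a \<odot>\<^bsub>?F\<^esub> f) x \<otimes> h x)"
      using a f by (intro linear_extension_superset[OF F.smult_closed[OF a f] h supp(2)[OF f] _ supp(1)[OF f]]) auto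
    also have "\<dots> = (\<Oplus>x\<in>?A. a \<otimes> (f x \<otimes> h x))"
    proof (rule add.finprod_cong')
      show "(\<lambda>x. a \<otimes> (f x \<otimes> h x)) \<in> ?A \<rightarrow> carrier R"
        using clos[OF f] supp(1)[OF f] a by blast
      show "(a \<odot>\<^bsub>?F\<^esub> f) x \<otimes> h x = a \<otimes> (f x \<otimes> h x)" if "x \<in> ?A" for x
      proof -
        have "h x \<in> carrier R" using that supp(1)[OF f] h by blast
        then show ?thesis using a f by (simp add: m_assoc)
      qed
    qed simp
    also have "\<dots> = a \<otimes> linear_extension R h f"
      unfolding linear_extension_def
      using clos[OF f] supp[OF f] a by (intro finsum_rdistr[symmetric]) blast+
    finally show ?thesis .
  qed
  ultimately show ?thesis by (simp add: linear_maps_def Pi_iff del: free_module_simps)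
qed

lemma (in cring) linear_extension_free_gen:
  assumes "x \<in> X" "h \<in> X \<rightarrow> carrier R"
  shows "linear_extension R h (free_gen R x) = h x"
proof -
  have hx: "h x \<in> carrier R" using assms by auto
  \<comment> \<open>The index set \<open>{x}\<close> is used in place of the true support, which is
    empty in the zero ring.\<close>
  have "linear_extension R h (free_gen R x) = (\<Oplus>y\<in>{x}. free_gen R x y \<otimes> h y)"
    using assms(1)
    by (intro linear_extension_superset[OF free_gen_closed[OF assms(1)] assms(2)])
      (auto simp: free_gen_def)
  then show ?thesis using hx by (simp add: free_gen_def)
qed

section \<open>Linear forms on modules and their descent to quotients\<close>

context module
begin

lemma linear_formD:
  assumes "f \<in> linear_maps R M (regular_module R)"
  shows "x \<in> carrier M \<Longrightarrow> f x \<in> carrier R"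
    and "\<lbrakk>x \<in> carrier M; y \<in> carrier M\<rbrakk> \<Longrightarrow> f (x \<oplus>\<^bsub>M\<^esub> y) = f x \<oplus> f y"
    and "\<lbrakk>a \<in> carrier R; x \<in> carrier M\<rbrakk> \<Longrightarrow> f (a \<odot>\<^bsub>M\<^esub> x) = a \<otimes> f x"
  using assms by (auto simp: linear_maps_def)

lemma linear_form_zero:
  assumes "f \<in> linear_maps R M (regular_module R)"
  shows "f \<zero>\<^bsub>M\<^esub> = \<zero>"
proof -
  have "f (\<zero> \<odot>\<^bsub>M\<^esub> \<zero>\<^bsub>M\<^esub>) = \<zero> \<otimes> f \<zero>\<^bsub>M\<^esub>"
    by (rule linear_formD(3)[OF assms]) auto
  then show ?thesis using linear_formD(1)[OF assms] by simp
qed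

lemma linear_form_minus:
  assumes f: "f \<in> linear_maps R M (regular_module R)" and x: "x \<in> carrier M"
  shows "f (\<ominus>\<^bsub>M\<^esub> x) = \<ominus> f x"
proof -
  have "f (\<ominus>\<^bsub>M\<^esub> x) = f ((\<ominus> \<one>) \<odot>\<^bsub>M\<^esub> x)" using x by (simp add: smult_l_minus)
  also have "\<dots> = (\<ominus> \<one>) \<otimes> f x" using x by (simp add: linear_formD(3)[OF f])
  also have "\<dots> = \<ominus> f x" using linear_formD(1)[OF f x] by (simp add: R.l_minus)
  finally show ?thesis .
qed

lemma linear_form_diff:
  assumes f: "f \<in> linear_maps R M (regular_module R)" and "x \<in> carrier M" "y \<in> carrier M"
  shows "f (x \<ominus>\<^bsub>M\<^esub> y) = f x \<ominus> f y"
  using assms by (simp add: M.minus_eq R.minus_eq linear_formD(2)[OF f] linear_form_minus[OF f])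

lemma submodule_linear_form_kernel:
  assumes f: "f \<in> linear_maps R M (regular_module R)"
  shows "submodule {x \<in> carrier M. f x = \<zero>} R M"
  by (rule submoduleI)
    (auto simp: linear_formD[OF f] linear_form_zero[OF f] linear_form_minus[OF f])

text \<open>As \<open>X\<close> lies in the carrier, the carrier is itself one of the intersected
  submodules. The family is therefore nonempty and its intersection stays inside the
  carrier.\<close>

lemma submodule_generated:
  assumes "X \<subseteq> carrier M"
  shows "submodule (generated_submodule R M X) R M"
proof (rule submoduleI)
  have carr: "submodule (carrier M) R M \<and> X \<subseteq> carrier M" using carrier_is_submodule assms by simp
  show "generated_submodule R M X \<subseteq> carrier M" unfolding generated_submodule_def using carr by blast
  show "\<zero>\<^bsub>M\<^esub> \<in> generated_submodule R M X"
    by (auto simp: generated_submodule_def dest!: submodule.axioms(1) subgroup.one_closed)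
qed (auto simp: generated_submodule_def dest: submoduleE)

lemma abelian_subgroup_submodule:
  assumes "submodule N R M"
  shows "abelian_subgroup N M"
  using assms by (intro abelian_subgroupI3 additive_subgroup.intro submodule.axioms(1) M.abelian_group_axioms)

lemma quotient_coset_add:
  assumes "submodule N R M" "x \<in> carrier M" "y \<in> carrier M"
  shows "(N +>\<^bsub>M\<^esub> x) \<oplus>\<^bsub>quotient_module M N\<^esub> (N +>\<^bsub>M\<^esub> y) = N +>\<^bsub>M\<^esub> (x \<oplus>\<^bsub>M\<^esub> y)"
  using abelian_subgroup.a_rcos_sum[OF abelian_subgroup_submodule[OF assms(1)] assms(2,3)] by simp

text \<open>The scalar action on a coset is a union over all its representatives. Since
  \<open>a\<close> maps \<open>N\<close> into itself, each representative \<open>n + x\<close>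
  yields the same coset, and the union, which is over a nonempty set, collapses to it.\<close>

lemma quotient_coset_smult:
  assumes N: "submodule N R M" and a: "a \<in> carrier R" and x: "x \<in> carrier M"
  shows "a \<odot>\<^bsub>quotient_module M N\<^esub> (N +>\<^bsub>M\<^esub> x) = N +>\<^bsub>M\<^esub> (a \<odot>\<^bsub>M\<^esub> x)"
proof -
  interpret N: abelian_subgroup N M by (rule abelian_subgroup_submodule[OF N])
  have "N +>\<^bsub>M\<^esub> (a \<odot>\<^bsub>M\<^esub> y) = N +>\<^bsub>M\<^esub> (a \<odot>\<^bsub>M\<^esub> x)" if y: "y \<in> N +>\<^bsub>M\<^esub> x" for y
  proof -
    obtain n where n: "n \<in> N" "y = n \<oplus>\<^bsub>M\<^esub> x" using y by (auto simp: a_r_coset_def')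
    have nc: "n \<in> carrier M" using n(1) N.a_subset by auto
    have "a \<odot>\<^bsub>M\<^esub> y = a \<odot>\<^bsub>M\<^esub> n \<oplus>\<^bsub>M\<^esub> a \<odot>\<^bsub>M\<^esub> x" using n nc a x by (simp add: smult_r_distr)
    moreover have "a \<odot>\<^bsub>M\<^esub> n \<in> N" using submoduleE(4)[OF N a n(1)] .
    ultimately have "a \<odot>\<^bsub>M\<^esub> y \<in> N +>\<^bsub>M\<^esub> (a \<odot>\<^bsub>M\<^esub> x)" by (auto simp: a_r_coset_def')
    then show ?thesis
      using M.a_repr_independence[OF _ _ submodule.axioms(1)[OF N]] a x by (metis smult_closed)
  qed
  moreover have "x \<in> N +>\<^bsub>M\<^esub> x" by (rule N.a_rcos_self[OF x])
  ultimately show ?thesis unfolding quotient_module_simps by blast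
qed

lemma quotient_carrierE:
  assumes "A \<in> carrier (quotient_module M N)"
  obtains x where "x \<in> carrier M" "A = N +>\<^bsub>M\<^esub> x"
  using assms by (auto simp: A_RCOSETS_def')

lemma quotient_coset_closed:
  assumes "submodule N R M" "x \<in> carrier M"
  shows "N +>\<^bsub>M\<^esub> x \<in> carrier (quotient_module M N)"
  using M.a_rcosetsI[OF submoduleE(1)[OF assms(1)] assms(2)] by simp

text \<open>The kernel of \<open>f\<close> is a submodule containing \<open>X\<close>, so it
  contains the generated submodule \<open>N\<close>, and \<open>f\<close> is constant on the cosets
  of \<open>N\<close>. This is the universal property of the quotient.\<close>

lemma linear_form_quotient:
  assumes f: "f \<in> linear_maps R M (regular_module R)"
    and X: "X \<subseteq> carrier M" and f0: "\<And>x. x \<in> X \<Longrightarrow> f x = \<zero>"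
  defines "N \<equiv> generated_submodule R M X"
  obtains g where "g \<in> linear_maps R (quotient_module M N) (regular_module R)"
    and "\<And>x. x \<in> carrier M \<Longrightarrow> g (N +>\<^bsub>M\<^esub> x) = f x"
proof
  \<comment> \<open>Any representative will do, because two representatives of a coset differ by an
    element of \<open>N\<close>.\<close>
  let ?g = "\<lambda>A. f (SOME x. x \<in> A)"
  have N: "submodule N R M" unfolding N_def by (rule submodule_generated[OF X])
  interpret N: abelian_subgroup N M by (rule abelian_subgroup_submodule[OF N])
  have ker: "f n = \<zero>" if "n \<in> N" for n
    using that submodule_linear_form_kernel[OF f] X f0
    unfolding N_def generated_submodule_def by blast
  show g: "?g (N +>\<^bsub>M\<^esub> x) = f x" if x: "x \<in> carrier M" for x
  proof -
    have "(SOME y. y \<in> N +>\<^bsub>M\<^esub> x) \<in> N +>\<^bsub>M\<^esub> x" using N.a_rcos_self[OF x] by (rule someI)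
    then obtain n where n: "n \<in> N" "(SOME y. y \<in> N +>\<^bsub>M\<^esub> x) = n \<oplus>\<^bsub>M\<^esub> x"
      by (auto simp: a_r_coset_def')
    then show ?thesis using x ker[OF n(1)] N.a_Hcarr by (simp add: linear_formD[OF f])
  qed
  show "?g \<in> linear_maps R (quotient_module M N) (regular_module R)"
    unfolding linear_maps_def regular_module_simps
  proof (intro CollectI conjI ballI funcsetI)
    fix A assume "A \<in> carrier (quotient_module M N)"
    then show "?g A \<in> carrier R"
      by (elim quotient_carrierE) (simp only: g linear_formD[OF f])
  next
    fix A B assume "A \<in> carrier (quotient_module M N)" "B \<in> carrier (quotient_module M N)"
    then show "?g (A \<oplus>\<^bsub>quotient_module M N\<^esub> B) = ?g A \<oplus> ?g B"
      by (elim quotient_carrierE) (simp only: g quotient_coset_add[OF N] linear_formD[OF f] M.a_closed)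
  next
    fix a A assume "a \<in> carrier R" "A \<in> carrier (quotient_module M N)"
    then show "?g (a \<odot>\<^bsub>quotient_module M N\<^esub> A) = a \<otimes> ?g A"
      by (elim quotient_carrierE) (simp only: g quotient_coset_smult[OF N] linear_formD[OF f] smult_closed)
  qed
qed

text \<open>These closure properties are all that the exterior power lemma asks of its module
  besides a linear form on it, so the module axioms for the quotient are never established.\<close>

lemma quotient_closed:
  assumes N: "submodule N R M"
  shows "\<lbrakk>A \<in> carrier (quotient_module M N); B \<in> carrier (quotient_module M N)\<rbrakk>
      \<Longrightarrow> A \<oplus>\<^bsub>quotient_module M N\<^esub> B \<in> carrier (quotient_module M N)"
    and "\<lbrakk>a \<in> carrier R; A \<in> carrier (quotient_module M N)\<rbrakk>
      \<Longrightarrow> a \<odot>\<^bsub>quotient_module M N\<^esub> A \<in> carrier (quotient_module M N)"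
  by (elim quotient_carrierE;
      simp only: quotient_coset_add[OF N] quotient_coset_smult[OF N] quotient_coset_closed[OF N]
        M.a_closed smult_closed)+

end

section \<open>The first exterior power and Kaehler differentials\<close>

lemma ext_gens_1: "ext_gens M 1 = {[x] | x. x \<in> carrier M}"
  by (auto simp: ext_gens_def length_Suc_conv)

text \<open>The first exterior power is the module itself in another presentation: a generator is a
  one-element list, and sending it to \<open>f\<close> of its head respects the relations. Only the
  inclusion of images is needed for the trace.\<close>

lemma (in cring) linear_form_exterior_power_1:
  assumes f: "f \<in> linear_maps R M (regular_module R)"
    and add_closed: "\<And>x y. \<lbrakk>x \<in> carrier M; y \<in> carrier M\<rbrakk> \<Longrightarrow> x \<oplus>\<^bsub>M\<^esub> y \<in> carrier M"
    and smult_closed: "\<And>a x. \<lbrakk>a \<in> carrier R; x \<in> carrier M\<rbrakk> \<Longrightarrow> a \<odot>\<^bsub>M\<^esub> x \<in> carrier M"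
  obtains g where "g \<in> linear_maps R (exterior_power R M 1) (regular_module R)"
    and "f ` carrier M \<subseteq> g ` carrier (exterior_power R M 1)"
proof -
  let ?X = "ext_gens M 1" and ?h = "\<lambda>ms. f (hd ms)"
  let ?F = "free_module R ?X" and ?e = "free_gen R"
  interpret F: module R ?F by (rule free_module_module)
  have f_closed: "f x \<in> carrier R" if "x \<in> carrier M" for x
    using f that by (auto simp: linear_maps_def)
  have f_add: "f (x \<oplus>\<^bsub>M\<^esub> y) = f x \<oplus> f y" if "x \<in> carrier M" "y \<in> carrier M" for x y
    using f that by (simp add: linear_maps_def)
  have f_smult: "f (a \<odot>\<^bsub>M\<^esub> x) = a \<otimes> f x" if "a \<in> carrier R" "x \<in> carrier M" for a x
    using f that by (simp add: linear_maps_def)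
  have h: "?h \<in> ?X \<rightarrow> carrier R" by (auto simp: ext_gens_1 f_closed simp del: One_nat_def)
  have e: "?e [x] \<in> carrier ?F" if "x \<in> carrier M" for x
    by (rule free_gen_closed) (use that in \<open>auto simp: ext_gens_1 simp del: One_nat_def\<close>)
  note lin = linear_extension_linear[OF h]
  have ext: "linear_extension R ?h (?e [x]) = f x" if "x \<in> carrier M" for x
    using that by (subst linear_extension_free_gen[OF _ h]) (auto simp: ext_gens_1 simp del: One_nat_def)
  have rels: "\<rho> \<in> carrier ?F \<and> linear_extension R ?h \<rho> = \<zero>" if "\<rho> \<in> ext_rels R M 1" for \<rho>
  proof -
    \<comment> \<open>In length one the updated position must be 0, so every updated list is a
      singleton. The alternating relations are absent, since no \<open>j < l < 1\<close>
      exist.\<close>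
    consider x y where "x \<in> carrier M" "y \<in> carrier M"
        "\<rho> = ?e [x \<oplus>\<^bsub>M\<^esub> y] \<ominus>\<^bsub>?F\<^esub> (?e [x] \<oplus>\<^bsub>?F\<^esub> ?e [y])"
      | a x where "a \<in> carrier R" "x \<in> carrier M"
        "\<rho> = ?e [a \<odot>\<^bsub>M\<^esub> x] \<ominus>\<^bsub>?F\<^esub> (a \<odot>\<^bsub>?F\<^esub> ?e [x])"
      using \<open>\<rho> \<in> ext_rels R M 1\<close>
      unfolding ext_rels_def Let_def ext_gens_1 by (fastforce simp del: free_module_simps)
    then show ?thesis
    proof cases
      case 1
      then show ?thesis
        using e[OF add_closed[OF 1(1,2)]] e[OF 1(1)] e[OF 1(2)]
        by (simp add: F.linear_form_diff[OF lin] F.linear_formD[OF lin] ext add_closed f_add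
            f_closed r_neg minus_eq F.M.minus_closed del: free_module_simps One_nat_def)
    next
      case 2
      then show ?thesis
        using e[OF smult_closed[OF 2(1,2)]] e[OF 2(2)]
        by (simp add: F.linear_form_diff[OF lin] F.linear_formD[OF lin] ext smult_closed f_smult
            f_closed r_neg minus_eq F.M.minus_closed del: free_module_simps One_nat_def)
    qed
  qed
  let ?N = "generated_submodule R ?F (ext_rels R M 1)"
  have sub: "ext_rels R M 1 \<subseteq> carrier ?F" using rels by blast
  obtain g where g: "g \<in> linear_maps R (quotient_module ?F ?N) (regular_module R)"
    and g_coset: "\<And>x. x \<in> carrier ?F \<Longrightarrow> g (?N +>\<^bsub>?F\<^esub> x) = linear_extension R ?h x"
    using F.linear_form_quotient[OF lin sub] rels by metis
  have ext_eq: "exterior_power R M 1 = quotient_module ?F ?N"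
    unfolding exterior_power_def Let_def ..
  show ?thesis
  proof
    show "g \<in> linear_maps R (exterior_power R M 1) (regular_module R)" unfolding ext_eq by (rule g)
    show "f ` carrier M \<subseteq> g ` carrier (exterior_power R M 1)"
    proof (rule image_subsetI)
      fix x assume x: "x \<in> carrier M"
      have "f x = g (?N +>\<^bsub>?F\<^esub> ?e [x])" by (simp only: g_coset[OF e[OF x]] ext[OF x])
      moreover have "?N +>\<^bsub>?F\<^esub> ?e [x] \<in> carrier (quotient_module ?F ?N)"
        by (rule F.quotient_coset_closed[OF F.submodule_generated[OF sub] e[OF x]])
      ultimately show "f x \<in> g ` carrier (exterior_power R M 1)" unfolding ext_eq by blast
    qed
  qed
qed

text \<open>By the universal property of the Kaehler differentials, \<open>D\<close> factors through
  the universal derivation: the form sending \<open>dx\<close> to \<open>D x\<close> kills the three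
  families of relations by \<open>D_add\<close>, \<open>D_mult\<close> and \<open>D_scalar\<close>
  respectively. It is then transported to the first exterior power.\<close>

lemma derivation_differential_forms_1:
  fixes K :: "('k, 'q) ring_scheme" and S (structure)
  assumes "algebra K S"
    and D_closed: "D \<in> carrier S \<rightarrow> carrier S"
    and D_add: "\<And>x y. \<lbrakk>x \<in> carrier S; y \<in> carrier S\<rbrakk> \<Longrightarrow> D (x \<oplus> y) = D x \<oplus> D y"
    and D_mult: "\<And>x y. \<lbrakk>x \<in> carrier S; y \<in> carrier S\<rbrakk> \<Longrightarrow> D (x \<otimes> y) = x \<otimes> D y \<oplus> y \<otimes> D x"
    and D_scalar: "\<And>c. c \<in> carrier K \<Longrightarrow> D (c \<odot> \<one>) = \<zero>"
  obtains g where "g \<in> linear_maps S (differential_forms K S 1) (regular_module S)"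
    and "D ` carrier S \<subseteq> g ` carrier (differential_forms K S 1)"
proof -
  interpret S: cring S using assms(1) by (rule algebra.M_cring)
  interpret algebra K S by fact
  let ?F = "free_module S (carrier S)" and ?d = "free_gen S"
  interpret F: module S ?F by (rule S.free_module_module)
  have D: "D x \<in> carrier S" if "x \<in> carrier S" for x using that D_closed by auto
  note lin = S.linear_extension_linear[OF D_closed]
  note d = S.free_gen_closed[of _ "carrier S"]
  note ext = S.linear_extension_free_gen[OF _ D_closed]
  have rels: "\<rho> \<in> carrier ?F \<and> linear_extension S D \<rho> = \<zero>" if "\<rho> \<in> kaehler_rels K S" for \<rho>
  proof -
    consider x y where "x \<in> carrier S" "y \<in> carrier S"
        "\<rho> = ?d (x \<oplus> y) \<ominus>\<^bsub>?F\<^esub> (?d x \<oplus>\<^bsub>?F\<^esub> ?d y)"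
      | x y where "x \<in> carrier S" "y \<in> carrier S"
        "\<rho> = ?d (x \<otimes> y) \<ominus>\<^bsub>?F\<^esub> (x \<odot>\<^bsub>?F\<^esub> ?d y \<oplus>\<^bsub>?F\<^esub> y \<odot>\<^bsub>?F\<^esub> ?d x)"
      | c where "c \<in> carrier K" "\<rho> = ?d (c \<odot> \<one>)"
      using \<open>\<rho> \<in> kaehler_rels K S\<close>
      unfolding kaehler_rels_def Let_def by blast
    then show ?thesis
    proof cases
      case 1
      then show ?thesis
        by (simp add: F.linear_form_diff[OF lin] F.linear_formD[OF lin] ext d D D_add
            S.r_neg S.minus_eq F.M.minus_closed del: free_module_simps)
    next
      case 2
      then show ?thesis
        by (simp add: F.linear_form_diff[OF lin] F.linear_formD[OF lin] ext d D D_mult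
            S.r_neg S.minus_eq F.M.minus_closed del: free_module_simps)
    next
      case 3
      then show ?thesis by (simp add: ext d D_scalar del: free_module_simps)
    qed
  qed
  let ?N = "generated_submodule S ?F (kaehler_rels K S)"
  have sub: "kaehler_rels K S \<subseteq> carrier ?F" using rels by blast
  note N = F.submodule_generated[OF sub]
  have omega: "kaehler_differentials K S = quotient_module ?F ?N"
    unfolding kaehler_differentials_def Let_def ..
  obtain f where f: "f \<in> linear_maps S (quotient_module ?F ?N) (regular_module S)"
    and f_coset: "\<And>x. x \<in> carrier ?F \<Longrightarrow> f (?N +>\<^bsub>?F\<^esub> x) = linear_extension S D x"
    using F.linear_form_quotient[OF lin sub] rels by metis
  obtain g where g: "g \<in> linear_maps S (exterior_power S (quotient_module ?F ?N) 1) (regular_module S)"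
    "f ` carrier (quotient_module ?F ?N) \<subseteq> g ` carrier (exterior_power S (quotient_module ?F ?N) 1)"
    using S.linear_form_exterior_power_1[OF f F.quotient_closed[OF N]] by metis
  have "D ` carrier S \<subseteq> f ` carrier (quotient_module ?F ?N)"
  proof (rule image_subsetI)
    fix x assume x: "x \<in> carrier S"
    have "D x = f (?N +>\<^bsub>?F\<^esub> ?d x)" by (simp only: f_coset[OF d[OF x]] ext[OF x])
    then show "D x \<in> f ` carrier (quotient_module ?F ?N)"
      using F.quotient_coset_closed[OF N d[OF x]] by blast
  qed
  then show ?thesis using g that unfolding differential_forms_def omega by blast
qed

section \<open>The Euler derivation\<close>

text \<open>The factor \<open>i\<close> acts as an \<open>i\<close>-fold sum in the ring itself, so
  the derivation laws hold over any graded ring; the field and its characteristic enter only for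
  surjectivity.\<close>

definition euler :: "('a, 'r) ring_scheme \<Rightarrow> (nat \<Rightarrow> 'a set) \<Rightarrow> 'a \<Rightarrow> 'a" where
  "euler R gr x = (let a = THE a. homogeneous_decomp R gr a x in
     (\<Oplus>\<^bsub>R\<^esub>i\<in>{i. a i \<noteq> \<zero>\<^bsub>R\<^esub>}. [i] \<cdot>\<^bsub>R\<^esub> a i))"

context graded_ring
begin

lemma gr_carrier: "x \<in> gr i \<Longrightarrow> x \<in> carrier R"
  using subgroup.subset[OF gr_subgroup] by auto

lemma gr_zero: "\<zero> \<in> gr i"
  using subgroup.one_closed[OF gr_subgroup] by simp

lemma gr_add: "\<lbrakk>x \<in> gr i; y \<in> gr i\<rbrakk> \<Longrightarrow> x \<oplus> y \<in> gr i"
  using subgroup.m_closed[OF gr_subgroup] by simp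

lemma homogeneous_decomp_sum:
  assumes "\<And>i. a i \<in> gr i" "finite A" "\<And>i. i \<notin> A \<Longrightarrow> a i = \<zero>"
  shows "homogeneous_decomp R gr a (\<Oplus>i\<in>A. a i)"
proof -
  have sub: "{i. a i \<noteq> \<zero>} \<subseteq> A" using assms(3) by auto
  have "(\<Oplus>i\<in>{i. a i \<noteq> \<zero>}. a i) = (\<Oplus>i\<in>A. a i)"
    using assms(2,3) sub gr_carrier[OF assms(1)]
    by (intro add.finprod_mono_neutral_cong_left) auto
  then show ?thesis
    unfolding homogeneous_decomp_def using assms(1) finite_subset[OF sub assms(2)] by auto
qed

text \<open>Uniqueness of the decomposition identifies the \<open>THE\<close> term with
  \<open>a\<close>. Allowing any finite \<open>A\<close> that contains the support lets several
  elements share one index set.\<close>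

lemma euler_sum:
  assumes a: "\<And>i. a i \<in> gr i" and A: "finite A" "\<And>i. i \<notin> A \<Longrightarrow> a i = \<zero>"
  shows "euler R gr (\<Oplus>i\<in>A. a i) = (\<Oplus>i\<in>A. [i] \<cdot> a i)"
proof -
  have hd: "homogeneous_decomp R gr a (\<Oplus>i\<in>A. a i)"
    using assms by (rule homogeneous_decomp_sum)
  have "(\<Oplus>i\<in>A. a i) \<in> carrier R" using gr_carrier[OF a] by auto
  then have "(THE a'. homogeneous_decomp R gr a' (\<Oplus>i\<in>A. a i)) = a"
    using gr_decomp hd by (intro the1_equality)
  then have "euler R gr (\<Oplus>i\<in>A. a i) = (\<Oplus>i\<in>{i. a i \<noteq> \<zero>}. [i] \<cdot> a i)"
    by (simp add: euler_def)
  also have "\<dots> = (\<Oplus>i\<in>A. [i] \<cdot> a i)"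
    using gr_carrier[OF a] A by (intro add.finprod_mono_neutral_cong_left) auto
  finally show ?thesis .
qed

lemma homogeneous_sumE:
  assumes "x \<in> carrier R"
  obtains a A where "\<And>i. a i \<in> gr i" "finite A" "\<And>i. i \<notin> A \<Longrightarrow> a i = \<zero>" "x = (\<Oplus>i\<in>A. a i)"
  using gr_decomp[OF assms] unfolding homogeneous_decomp_def by blast

lemma euler_homogeneous:
  assumes "x \<in> gr i"
  shows "euler R gr x = [i] \<cdot> x"
proof -
  \<comment> \<open>The family concentrated in degree \<open>i\<close>, summed over
    \<open>{i}\<close>, also covers the case that \<open>x\<close> is zero.\<close>
  have "euler R gr (\<Oplus>j\<in>{i}. if j = i then x else \<zero>) = (\<Oplus>j\<in>{i}. [j] \<cdot> (if j = i then x else \<zero>))"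
    by (rule euler_sum) (use assms gr_zero in auto)
  then show ?thesis using gr_carrier[OF assms] by simp
qed

lemma euler_closed: "x \<in> carrier R \<Longrightarrow> euler R gr x \<in> carrier R"
proof (erule homogeneous_sumE)
  fix a A assume a: "\<And>i. a i \<in> gr i" "finite A" "\<And>i. i \<notin> A \<Longrightarrow> a i = \<zero>" "x = (\<Oplus>i\<in>A. a i)"
  then have "euler R gr x = (\<Oplus>i\<in>A. [i] \<cdot> a i)" by (simp add: euler_sum)
  also have "\<dots> \<in> carrier R" using gr_carrier[OF a(1)] by (intro finsum_closed) auto
  finally show ?thesis .
qed

lemma euler_add:
  assumes "x \<in> carrier R" "y \<in> carrier R"
  shows "euler R gr (x \<oplus> y) = euler R gr x \<oplus> euler R gr y"
proof -
  obtain a A where a: "\<And>i. a i \<in> gr i" "finite A" "\<And>i. i \<notin> A \<Longrightarrow> a i = \<zero>" "x = (\<Oplus>i\<in>A. a i)"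
    using homogeneous_sumE[OF assms(1)] by blast
  obtain b B where b: "\<And>i. b i \<in> gr i" "finite B" "\<And>i. i \<notin> B \<Longrightarrow> b i = \<zero>" "y = (\<Oplus>i\<in>B. b i)"
    using homogeneous_sumE[OF assms(2)] by blast
  have carr: "a i \<in> carrier R" "b i \<in> carrier R" for i using a(1) b(1) gr_carrier by auto
  \<comment> \<open>Both decompositions are extended by zero to a common index set, so that the sum
    is formed degree by degree.\<close>
  let ?C = "A \<union> B"
  have x: "x = (\<Oplus>i\<in>?C. a i)"
    unfolding a(4) using a b carr by (intro add.finprod_mono_neutral_cong_left) auto
  have y: "y = (\<Oplus>i\<in>?C. b i)"
    unfolding b(4) using a b carr by (intro add.finprod_mono_neutral_cong_left) auto
  have "x \<oplus> y = (\<Oplus>i\<in>?C. a i \<oplus> b i)"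
    unfolding x y using carr by (intro finsum_addf[symmetric]) auto
  also have "euler R gr \<dots> = (\<Oplus>i\<in>?C. [i] \<cdot> (a i \<oplus> b i))"
    by (rule euler_sum) (use a b in \<open>auto intro: gr_add\<close>)
  also have "\<dots> = (\<Oplus>i\<in>?C. [i] \<cdot> a i \<oplus> [i] \<cdot> b i)"
    using carr by (simp add: add.nat_pow_distrib)
  also have "\<dots> = (\<Oplus>i\<in>?C. [i] \<cdot> a i) \<oplus> (\<Oplus>i\<in>?C. [i] \<cdot> b i)"
    using carr by (intro finsum_addf) auto
  also have "\<dots> = euler R gr x \<oplus> euler R gr y"
  proof -
    have "euler R gr x = (\<Oplus>i\<in>?C. [i] \<cdot> a i)" unfolding x by (rule euler_sum) (use a b in auto)
    moreover have "euler R gr y = (\<Oplus>i\<in>?C. [i] \<cdot> b i)" unfolding y by (rule euler_sum) (use a b in auto)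
    ultimately show ?thesis by simp
  qed
  finally show ?thesis .
qed

text \<open>Every element is a finite sum of homogeneous ones. There is no separate case for zero,
  since zero is homogeneous of every degree.\<close>

lemma homogeneous_induct [consumes 1, case_names homogeneous add]:
  assumes "x \<in> carrier R"
    and hom: "\<And>i x. x \<in> gr i \<Longrightarrow> P x"
    and add: "\<And>x y. \<lbrakk>x \<in> carrier R; y \<in> carrier R; P x; P y\<rbrakk> \<Longrightarrow> P (x \<oplus> y)"
  shows "P x"
proof -
  obtain a A where a: "\<And>i. a i \<in> gr i" "finite A" "x = (\<Oplus>i\<in>A. a i)"
    using homogeneous_sumE[OF assms(1)] by blast
  have carr: "a i \<in> carrier R" for i using a(1) gr_carrier by auto
  have "P (\<Oplus>i\<in>A. a i)" using a(2)
  proof (induction rule: finite_induct)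
    case empty
    show ?case using hom[OF gr_zero] by simp
  next
    case (insert i A)
    then show ?case using carr by (auto intro!: add hom[OF a(1)] finsum_closed)
  qed
  then show ?thesis using a(3) by simp
qed

text \<open>Both sides are additive in \<open>x\<close> and in \<open>y\<close>, so homogeneous
  factors suffice. In degrees \<open>i\<close> and \<open>j\<close> the Leibniz rule is just the
  splitting of the factor \<open>i + j\<close>.\<close>

lemma euler_mult:
  assumes "x \<in> carrier R" "y \<in> carrier R"
  shows "euler R gr (x \<otimes> y) = x \<otimes> euler R gr y \<oplus> y \<otimes> euler R gr x"
  using assms
proof (induction x rule: homogeneous_induct)
  case (homogeneous i x)
  note x = gr_carrier[OF homogeneous(1)]
  show ?case using homogeneous(2)
  proof (induction y rule: homogeneous_induct)
    case (homogeneous j y)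
    note y = gr_carrier[OF homogeneous]
    have "euler R gr (x \<otimes> y) = [(i + j)] \<cdot> (x \<otimes> y)"
      by (intro euler_homogeneous gr_mult \<open>x \<in> gr i\<close> homogeneous)
    also have "\<dots> = [j] \<cdot> (x \<otimes> y) \<oplus> [i] \<cdot> (y \<otimes> x)"
      using x y by (simp add: add.nat_pow_mult[symmetric] a_comm m_comm)
    also have "\<dots> = x \<otimes> euler R gr y \<oplus> y \<otimes> euler R gr x"
      using x y by (simp add: euler_homogeneous[OF \<open>x \<in> gr i\<close>] euler_homogeneous[OF homogeneous]
          add_pow_rdistr)
    finally show ?case .
  next
    case (add y z)
    then show ?case using x by (simp add: r_distr l_distr euler_add euler_closed a_ac)
  qed
next
  case (add x z)
  then show ?case by (simp add: r_distr l_distr euler_add euler_closed a_ac)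
qed

end

section \<open>Characteristic zero: the Euler derivation covers the irrelevant ideal\<close>

lemma (in algebra) add_pow_smult:
  assumes "c \<in> carrier R" "x \<in> carrier M"
  shows "[(n::nat)] \<cdot>\<^bsub>M\<^esub> (c \<odot>\<^bsub>M\<^esub> x) = ([n] \<cdot>\<^bsub>R\<^esub> c) \<odot>\<^bsub>M\<^esub> x"
  using assms by (induction n) (simp_all add: smult_l_distr)

text \<open>If \<open>x\<close> has components \<open>a i\<close> with \<open>a 0\<close> zero, a
  preimage is obtained by dividing each \<open>a i\<close> with \<open>i > 0\<close> by
  \<open>i\<close>.\<close>

lemma irrelevant_ideal_subset_euler:
  fixes K :: "('k, 'q) ring_scheme" and S (structure)
  assumes "field K" and char0: "\<And>n::nat. n > 0 \<Longrightarrow> [n] \<cdot>\<^bsub>K\<^esub> \<one>\<^bsub>K\<^esub> \<noteq> \<zero>\<^bsub>K\<^esub>"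
    and "algebra K S" "graded_ring S gr"
    and scalars: "\<And>c. c \<in> carrier K \<Longrightarrow> c \<odot> \<one> \<in> gr 0"
  shows "irrelevant_ideal S gr \<subseteq> euler S gr ` carrier S"
proof
  interpret K: field K by fact
  interpret S: graded_ring S gr by fact
  interpret algebra K S by fact
  fix x assume "x \<in> irrelevant_ideal S gr"
  then obtain a where a: "\<And>i. a i \<in> gr i" and fin: "finite {i. a i \<noteq> \<zero>}"
    and x: "x = (\<Oplus>i\<in>{i. a i \<noteq> \<zero>}. a i)" and a0: "a 0 = \<zero>"
    by (auto simp: irrelevant_ideal_def homogeneous_decomp_def)
  \<comment> \<open>This is 1/i in \<open>K\<close>, meaningful for \<open>i > 0\<close> by
    characteristic zero. At \<open>i = 0\<close> the inverse is unspecified, so \<open>?b\<close>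
    gets the explicit value zero there.\<close>
  let ?c = "\<lambda>i::nat. inv\<^bsub>K\<^esub> ([i] \<cdot>\<^bsub>K\<^esub> \<one>\<^bsub>K\<^esub>)"
  let ?b = "\<lambda>i. if i = 0 then \<zero> else ?c i \<odot> a i" and ?A = "{i. a i \<noteq> \<zero>}"
  have unit: "[i] \<cdot>\<^bsub>K\<^esub> \<one>\<^bsub>K\<^esub> \<in> Units K" if "i > 0" for i :: nat
    using char0[OF that] by (simp add: K.field_Units)
  have c: "?c i \<in> carrier K" if "i > 0" for i using K.Units_inv_closed[OF unit[OF that]] .
  have ac: "a i \<in> carrier S" for i using a S.gr_carrier by auto
  have b: "?b i \<in> gr i" for i
  proof (cases "i = 0")
    case False
    \<comment> \<open>A scalar acts as multiplication by an element of degree 0, so it preserves the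
      degree of \<open>a i\<close>.\<close>
    have "?c i \<odot> a i = (?c i \<odot> \<one>) \<otimes> a i"
      using c False ac by (simp add: smult_assoc2)
    also have "\<dots> \<in> gr (0 + i)" using scalars c False a by (intro S.gr_mult) auto
    finally show ?thesis using False by simp
  qed (simp add: S.gr_zero)
  have ib: "[i] \<cdot> ?b i = a i" if "i \<in> ?A" for i
  proof -
    have i: "i > 0" using that a0 by (cases i) auto
    have "[i] \<cdot>\<^bsub>K\<^esub> ?c i = ([i] \<cdot>\<^bsub>K\<^esub> \<one>\<^bsub>K\<^esub>) \<otimes>\<^bsub>K\<^esub> ?c i"
      using c[OF i] by (simp add: K.add_pow_ldistr)
    also have "\<dots> = \<one>\<^bsub>K\<^esub>" by (rule K.Units_r_inv[OF unit[OF i]])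
    finally show ?thesis using i ac c[OF i] by (simp add: add_pow_smult)
  qed
  have b_zero: "?b i = \<zero>" if "i \<notin> ?A" for i
    using that c[of i] by auto
  have "euler S gr (\<Oplus>i\<in>?A. ?b i) = (\<Oplus>i\<in>?A. [i] \<cdot> ?b i)"
    by (rule S.euler_sum[OF b fin b_zero])
  also have "\<dots> = x" unfolding x
    by (rule S.add.finprod_cong') (use ib ac in auto)
  finally have "x = euler S gr (\<Oplus>i\<in>?A. ?b i)" ..
  moreover have "(\<Oplus>i\<in>?A. ?b i) \<in> carrier S"
    using b S.gr_carrier by (intro S.finsum_closed) blast
  ultimately show "x \<in> euler S gr ` carrier S" by blast
qed

section \<open>The trace ideal and the conclusion\<close>

lemma (in cring) image_subset_trace_ideal:
  assumes "f \<in> linear_maps R M (regular_module R)"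
  shows "f ` carrier M \<subseteq> trace_ideal R M"
proof
  fix y assume y: "y \<in> f ` carrier M"
  then have "y \<in> carrier R" using assms by (auto simp: linear_maps_def)
  \<comment> \<open>One form is enough: \<open>y\<close> is a trace sum with a single summand,
    indexed by \<open>f\<close>.\<close>
  then have "y = (\<Oplus>h\<in>{f}. y)" by simp
  then show "y \<in> trace_ideal R M"
    unfolding trace_ideal_def using assms y
    by (intro CollectI exI[of _ "{f}"] exI[of _ "\<lambda>_. y"]) auto
qed

theorem corollary5p5:
  fixes K :: "('k, 'q) ring_scheme"
    and S :: "('k, 's, 'm) module_scheme"
    and gr :: "nat \<Rightarrow> 's set"
  assumes "field K"
    and "\<And>n::nat. n > 0 \<Longrightarrow> [n] \<cdot>\<^bsub>K\<^esub> \<one>\<^bsub>K\<^esub> \<noteq> \<zero>\<^bsub>K\<^esub>"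
    and "algebra K S"
    and "noetherian_ring S"
    and "graded_ring S gr"
    and "bij_betw (\<lambda>c. c \<odot>\<^bsub>S\<^esub> \<one>\<^bsub>S\<^esub>) (carrier K) (gr 0)"
    and "krull_dim S = 1"
  shows "nearly_regular K S gr"
proof -
  interpret S: graded_ring S gr by fact
  have scalars: "c \<odot>\<^bsub>S\<^esub> \<one>\<^bsub>S\<^esub> \<in> gr 0" if "c \<in> carrier K" for c
    using bij_betwE[OF assms(6)] that by blast
  \<comment> \<open>The scalars have degree 0, so the Euler derivation multiplies them by 0.\<close>
  have kills: "euler S gr (c \<odot>\<^bsub>S\<^esub> \<one>\<^bsub>S\<^esub>) = \<zero>\<^bsub>S\<^esub>" if "c \<in> carrier K" for c
    using S.euler_homogeneous[OF scalars[OF that]] by simp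
  have closed: "euler S gr \<in> carrier S \<rightarrow> carrier S" using S.euler_closed by blast
  obtain g where g: "g \<in> linear_maps S (differential_forms K S 1) (regular_module S)"
    "euler S gr ` carrier S \<subseteq> g ` carrier (differential_forms K S 1)"
    using derivation_differential_forms_1[OF assms(3) closed S.euler_add S.euler_mult kills] by metis
  have "irrelevant_ideal S gr \<subseteq> euler S gr ` carrier S"
    by (rule irrelevant_ideal_subset_euler[OF assms(1-3,5) scalars])
  then have "irrelevant_ideal S gr \<subseteq> trace_ideal S (differential_forms K S 1)"
    using g(2) S.image_subset_trace_ideal[OF g(1)] by blast
  \<comment> \<open>The dimension hypothesis supplies the witness \<open>n = 1\<close>, so the top
    forms are exactly the first exterior power treated above.\<close>
  then show ?thesis
    unfolding nearly_regular_def using assms(7) by (auto simp: one_enat_def)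
qed

end
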